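(* Let $P\in\mathbb{P}_m(\mathbb{C}^{n\times n})$ be a regular Hermitian polynomial and let $(\lambda,x)\in\mathbb{C}\times\mathbb{C}^n$ be such that $\|x\|_2=1$ and $P(\lambda)x\ne0$. Let $\mathbb{S}$ be one of the two structures Hermitian or skew-Hermitian, and let $L\in\mathbb{L}_1(P)$ be a linearization of $P$ having the structure $\mathbb{S}$, with normalized right ansatz vector $v$ ($\|v\|_2=1$). Let $\Lambda_{m-1}:=[\lambda^{m-1},\ldots,\lambda,1]^T$. If $\lambda\in\mathbb{R}$ then $$\sqrt{\frac{m+1}{2m}}\le\frac{\eta_F^{\mathbb{S}}(\lambda,\Lambda_{m-1}\otimes x,L;v)}{\eta_F^{\mathrm{Herm}}(\lambda,x,P)}\le\sqrt2\quad\text{and}\quad\sqrt{\frac{m+1}{2m}}\le\frac{\eta_2^{\mathbb{S}}(\lambda,\Lambda_{m-1}\otimes x,L;v)}{\eta_2^{\mathrm{Herm}}(\lambda,x,P)}\le1.$$ The same bounds hold when $P$ is skew-Hermitian (with $\eta_M^{\mathrm{Herm}}(\lambda,x,P)$ replaced by $\eta_M^{\mathrm{skew\text{-}Herm}}(\lambda,x,P)$, $M\in\{2,F\}$).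
   Context: $m,n\ge1$ are integers. $\mathbb{P}_k(\mathbb{C}^{N\times N})$ is the vector space of matrix polynomials $Q(z)=\sum_{j=0}^k z^jA_j$, $A_j\in\mathbb{C}^{N\times N}$. $Q$ is regular if $\det Q(z)\not\equiv0$; Hermitian if all $A_j^H=A_j$; skew-Hermitian if all $A_j^H=-A_j$; $\mathrm{Herm}$ and $\mathrm{skew\text{-}Herm}$ denote the corresponding sets. For $M\in\{2,F\}$, $|||Q|||_M:=\left(\sum_{j=0}^k\|A_j\|_M^2\right)^{1/2}$ with $\|\cdot\|_F$ Frobenius and $\|\cdot\|_2$ spectral norm. For $\lambda\in\mathbb{C}$, $u\in\mathbb{C}^N\setminus\{0\}$, a structure class $\mathbb{S}\subset\mathbb{P}_k(\mathbb{C}^{N\times N})$ and regular $Q\in\mathbb{S}$, $\eta_M^{\mathbb{S}}(\lambda,u,Q):=\inf\{|||\Delta Q|||_M:\Delta Q\in\mathbb{S},\ Q(\lambda)u+\Delta Q(\lambda)u=0\}$. $\mathbb{L}_1(P)$ is the set of pencils $L(z)=zX+Y$, $X,Y\in\mathbb{C}^{mn\times mn}$, for which there is $v\in\mathbb{C}^m$ (the right ansatz vector of $L$) with $L(z)\,([z^{m-1},z^{m-2},\ldots,1]^T\otimes I_n)=v\otimes P(z)$ for all $z$; $\otimes$ is the Kronecker product. $L$ is a linearization of $P$ if there are unimodular matrix polynomials $E,F$ with $E(z)L(z)F(z)=\mathrm{diag}(P(z),I_{(m-1)n})$. The pencil $L$ is viewed as an element of $\mathbb{P}_1(\mathbb{C}^{mn\times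 mn})$ and its structured backward errors are taken over all pencils of structure $\mathbb{S}$ in that space; the $v$ in $\eta_M^{\mathbb{S}}(\lambda,\cdot,L;v)$ only records the ansatz vector. *)

theory Defs
  imports "Jordan_Normal_Form.Schur_Decomposition"
begin

section \<open>Norms\<close>

definition vec_norm2 :: "complex vec \<Rightarrow> real" where
  "vec_norm2 x = sqrt (\<Sum>i<dim_vec x. (cmod (x $ i))\<^sup>2)"

definition frobenius_norm :: "complex mat \<Rightarrow> real" where
  "frobenius_norm A = sqrt (\<Sum>i<dim_row A. \<Sum>j<dim_col A. (cmod (A $$ (i, j)))\<^sup>2)"

definition spectral_norm :: "complex mat \<Rightarrow> real" where
  "spectral_norm A =
     Sup {vec_norm2 (A *\<^sub>v x) | x. x \<in> carrier_vec (dim_col A) \<and> vec_norm2 x = 1}"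


section \<open>Matrix polynomials\<close>

text \<open>
  A matrix polynomial is a matrix over the ring of complex polynomials. The number \<open>k\<close> is
  the grade: the leading coefficients may vanish.
\<close>

definition mat_polys :: "nat \<Rightarrow> nat \<Rightarrow> complex poly mat set" where
  "mat_polys k N = {Q \<in> carrier_mat N N. \<forall>i<N. \<forall>j<N. degree (Q $$ (i, j)) \<le> k}"

definition mat_coeff :: "complex poly mat \<Rightarrow> nat \<Rightarrow> complex mat" where
  "mat_coeff Q j = map_mat (\<lambda>p. coeff p j) Q"

definition mat_eval :: "complex poly mat \<Rightarrow> complex \<Rightarrow> complex mat" where
  "mat_eval Q z = map_mat (\<lambda>p. poly p z) Q"

definition regular :: "complex poly mat \<Rightarrow> bool" where
  "regular Q \<longleftrightarrow> det Q \<noteq> 0"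

definition Herm :: "nat \<Rightarrow> nat \<Rightarrow> complex poly mat set" where
  "Herm k N = {Q \<in> mat_polys k N. \<forall>j\<le>k. mat_adjoint (mat_coeff Q j) = mat_coeff Q j}"

definition skew_Herm :: "nat \<Rightarrow> nat \<Rightarrow> complex poly mat set" where
  "skew_Herm k N = {Q \<in> mat_polys k N. \<forall>j\<le>k. mat_adjoint (mat_coeff Q j) = - mat_coeff Q j}"

definition mat_poly_norm :: "(complex mat \<Rightarrow> real) \<Rightarrow> nat \<Rightarrow> complex poly mat \<Rightarrow> real" where
  "mat_poly_norm nrm k Q = sqrt (\<Sum>j\<le>k. (nrm (mat_coeff Q j))\<^sup>2)"


section \<open>Structured backward error\<close>

text \<open>
  \<open>S\<close> is the set of admissible perturbations of grade \<open>k\<close>. The infimum is a real number; this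
  is the intended value when \<open>Q \<in> S\<close> and \<open>S\<close> is closed under negation, since then \<open>- Q\<close> is
  admissible and the set of norms is not empty.
\<close>

definition backward_error ::
  "(complex mat \<Rightarrow> real) \<Rightarrow> complex poly mat set \<Rightarrow> nat \<Rightarrow> complex \<Rightarrow> complex vec \<Rightarrow>
   complex poly mat \<Rightarrow> real" where
  "backward_error nrm S k lam u Q =
     Inf {mat_poly_norm nrm k D | D.
            D \<in> S \<and> mat_eval Q lam *\<^sub>v u + mat_eval D lam *\<^sub>v u = 0\<^sub>v (dim_row Q)}"


section \<open>Kronecker products and the ansatz space\<close>

definition kron :: "'a::times mat \<Rightarrow> 'a mat \<Rightarrow> 'a mat" where
  "kron A B = mat (dim_row A * dim_row B) (dim_col A * dim_col B)
     (\<lambda>(i, j). A $$ (i div dim_row B, j div dim_col B) * B $$ (i mod dim_row B, j mod dim_col B))"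

definition col_mat :: "'a vec \<Rightarrow> 'a mat" where
  "col_mat v = mat_of_cols (dim_vec v) [v]"

definition kron_vec :: "'a::times vec \<Rightarrow> 'a vec \<Rightarrow> 'a vec" where
  "kron_vec u x = col (kron (col_mat u) (col_mat x)) 0"

text \<open>The vector with the \<open>k + 1\<close> entries \<open>z ^ k, \<dots>, z, 1\<close>.\<close>

definition Lam :: "nat \<Rightarrow> complex \<Rightarrow> complex vec" where
  "Lam k z = vec (Suc k) (\<lambda>i. z ^ (k - i))"

definition right_ansatz_vector ::
  "nat \<Rightarrow> nat \<Rightarrow> complex poly mat \<Rightarrow> complex poly mat \<Rightarrow> complex vec \<Rightarrow> bool" where
  "right_ansatz_vector m n P L v \<longleftrightarrow> v \<in> carrier_vec m \<and>
     (\<forall>z. mat_eval L z * kron (col_mat (Lam (m - 1) z)) (1\<^sub>m n)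
            = kron (col_mat v) (mat_eval P z))"

definition L1_space :: "nat \<Rightarrow> nat \<Rightarrow> complex poly mat \<Rightarrow> complex poly mat set" where
  "L1_space m n P = {L \<in> mat_polys 1 (m * n). \<exists>v. right_ansatz_vector m n P L v}"


section \<open>Linearizations\<close>

definition unimodular :: "nat \<Rightarrow> complex poly mat \<Rightarrow> bool" where
  "unimodular N E \<longleftrightarrow> E \<in> carrier_mat N N \<and> (\<exists>c. c \<noteq> 0 \<and> det E = [:c:])"

definition linearization :: "nat \<Rightarrow> nat \<Rightarrow> complex poly mat \<Rightarrow> complex poly mat \<Rightarrow> bool" where
  "linearization m n P L \<longleftrightarrow>
     (\<exists>E F. unimodular (m * n) E \<and> unimodular (m * n) F \<and>
        E * L * F = diag_block_mat [P, 1\<^sub>m ((m - 1) * n)])"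

end

theory Submission
  imports Defs "HOL-Analysis.L2_Norm"
begin

text \<open>
  At a real point \<open>\<lambda>\<close> the value of a structured perturbation is an arbitrary structured matrix
  \<open>E\<close>, and the cheapest way to produce \<open>E\<close> is to give the coefficient of degree \<open>j\<close> the share
  \<open>\<lambda>\<^sup>j E / w\<^sub>k\<close> with \<open>w\<^sub>k = \<Sum>j\<le>k. \<lambda>\<^sup>2\<^sup>j\<close>. So the backward error is \<open>1 / sqrt w\<^sub>k\<close> times the
  least norm of a structured solution of \<open>E u = r\<close>, \<open>r = - Q(\<lambda>) u\<close>. For a unit vector \<open>u\<close> this
  least norm is \<open>\<parallel>r\<parallel>\<close> in the spectral case and the square root of
  \<open>2 \<parallel>r\<parallel>\<^sup>2 - \<bar>\<langle>u, r\<rangle>\<bar>\<^sup>2\<close> in the Frobenius case. The ansatz equation gives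
  \<open>L(\<lambda>) (\<Lambda> \<otimes> x) = v \<otimes> P(\<lambda>) x\<close>, so the spectral ratio is exactly
  \<open>sqrt (w\<^sub>m / (w\<^bsub>m-1\<^esub> w\<^sub>1))\<close>, and the Frobenius ratio differs from it by a factor between
  \<open>1\<close> and \<open>sqrt 2\<close>. The lower bound for \<open>w\<^sub>m / (w\<^bsub>m-1\<^esub> w\<^sub>1)\<close> comes from
  \<open>(1 - q\<^sup>j) (1 - q\<^bsup>m-j\<^esup>) \<ge> 0\<close> with \<open>q = \<lambda>\<^sup>2\<close>.
\<close>

section \<open>Norms and structured matrices\<close>

text \<open>Conjugate-linear in the first argument. It takes index functions instead of vectors, so
  that combinations such as \<open>r - a u\<close> can be written as lambda terms without carrier
  conditions.\<close>

definition cinner :: "nat \<Rightarrow> (nat \<Rightarrow> complex) \<Rightarrow> (nat \<Rightarrow> complex) \<Rightarrow> complex" where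
  "cinner N f g = (\<Sum>i<N. cnj (f i) * g i)"

lemma cinner_add_left: "cinner N (\<lambda>i. f i + g i) h = cinner N f h + cinner N g h"
  by (simp add: cinner_def sum.distrib algebra_simps)

lemma cinner_add_right: "cinner N h (\<lambda>i. f i + g i) = cinner N h f + cinner N h g"
  by (simp add: cinner_def sum.distrib algebra_simps)

lemma cinner_diff_left: "cinner N (\<lambda>i. f i - g i) h = cinner N f h - cinner N g h"
  by (simp add: cinner_def sum_subtractf algebra_simps)

lemma cinner_diff_right: "cinner N h (\<lambda>i. f i - g i) = cinner N h f - cinner N h g"
  by (simp add: cinner_def sum_subtractf algebra_simps)

lemma cinner_scale_left: "cinner N (\<lambda>i. c * f i) h = cnj c * cinner N f h"
  by (simp add: cinner_def sum_distrib_left algebra_simps)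

lemma cinner_scale_right: "cinner N h (\<lambda>i. c * f i) = c * cinner N h f"
  by (simp add: cinner_def sum_distrib_left algebra_simps)

lemmas cinner_simps = cinner_add_left cinner_add_right cinner_diff_left cinner_diff_right
  cinner_scale_left cinner_scale_right

lemma cnj_cinner: "cnj (cinner N f g) = cinner N g f"
  by (simp add: cinner_def algebra_simps)

lemma cinner_cong:
  assumes "\<And>i. i < N \<Longrightarrow> f i = f' i" "\<And>i. i < N \<Longrightarrow> g i = g' i"
  shows "cinner N f g = cinner N f' g'"
  using assms by (simp add: cinner_def)

lemma cinner_self: "cinner N f f = of_real (\<Sum>i<N. (cmod (f i))\<^sup>2)"
  by (simp add: cinner_def complex_norm_square mult.commute flip: of_real_power)

lemma cinner_vec_norm2:
  assumes "v \<in> carrier_vec N"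
  shows "cinner N (($) v) (($) v) = of_real ((vec_norm2 v)\<^sup>2)"
  using assms by (auto simp: cinner_self vec_norm2_def sum_nonneg)

lemma cinner_uminus_vec:
  assumes "v \<in> carrier_vec N"
  shows "cinner N f (($) (- v)) = - cinner N f (($) v)"
  using assms by (simp add: cinner_def sum_negf)

lemma vec_add_eq_0:
  fixes v w :: "'a::ab_group_add vec"
  assumes "v \<in> carrier_vec N" "w \<in> carrier_vec N" "v + w = 0\<^sub>v N"
  shows "w = - v"
proof (rule eq_vecI)
  fix i assume "i < dim_vec (- v)"
  then have i: "i < N" using assms(1) by simp
  then have "(v + w) $ i = 0" unfolding assms(3) by simp
  then show "w $ i = (- v) $ i" using i assms(1,2) by (simp add: minus_unique)
qed (use assms in simp)

section \<open>Euclidean norm of vectors\<close>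

lemma vec_norm2_L2_set: "vec_norm2 v = L2_set (\<lambda>i. cmod (v $ i)) {..<dim_vec v}"
  by (simp add: vec_norm2_def L2_set_def)

lemma vec_norm2_nonneg [simp]: "vec_norm2 v \<ge> 0"
  by (simp add: vec_norm2_L2_set)

lemma vec_norm2_eq_0_iff:
  assumes "v \<in> carrier_vec N"
  shows "vec_norm2 v = 0 \<longleftrightarrow> v = 0\<^sub>v N"
  using assms by (auto simp: vec_norm2_L2_set L2_set_eq_0_iff)

lemma vec_norm2_smult: "vec_norm2 (c \<cdot>\<^sub>v v) = cmod c * vec_norm2 v"
  by (simp add: vec_norm2_def norm_mult power_mult_distrib real_sqrt_mult flip: sum_distrib_left)

lemma vec_norm2_unit_vec:
  assumes "i < N"
  shows "vec_norm2 (unit_vec N i) = 1"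
proof -
  have "(\<Sum>j<N. (cmod (unit_vec N i $ j))\<^sup>2) = (\<Sum>j<N. if j = i then 1 else 0)"
    using assms by (intro sum.cong) auto
  then show ?thesis using assms by (simp add: vec_norm2_def)
qed

lemma vec_norm2_add:
  assumes "v \<in> carrier_vec N" "w \<in> carrier_vec N"
  shows "vec_norm2 (v + w) \<le> vec_norm2 v + vec_norm2 w"
proof -
  have "vec_norm2 (v + w) \<le> L2_set (\<lambda>i. cmod (v $ i) + cmod (w $ i)) {..<N}"
    using assms by (auto simp: vec_norm2_L2_set intro!: L2_set_mono norm_triangle_ineq)
  also have "\<dots> \<le> vec_norm2 v + vec_norm2 w"
    using assms L2_set_triangle_ineq by (auto simp: vec_norm2_L2_set)
  finally show ?thesis .
qed

lemma cmod_cinner_le: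
  assumes "v \<in> carrier_vec N" "w \<in> carrier_vec N"
  shows "cmod (cinner N (($) v) (($) w)) \<le> vec_norm2 v * vec_norm2 w"
proof -
  have "cmod (cinner N (($) v) (($) w)) \<le> (\<Sum>i<N. \<bar>cmod (v $ i)\<bar> * \<bar>cmod (w $ i)\<bar>)"
    unfolding cinner_def by (rule order_trans[OF norm_sum]) (simp add: norm_mult)
  also have "\<dots> \<le> vec_norm2 v * vec_norm2 w"
    using assms L2_set_mult_ineq[of "\<lambda>i. cmod (v $ i)" "\<lambda>i. cmod (w $ i)" "{..<N}"] 
    by (simp add: vec_norm2_L2_set)
  finally show ?thesis .
qed

lemma mult_mat_vec_index:
  assumes "A \<in> carrier_mat N M" "y \<in> carrier_vec M" "i < N"
  shows "(A *\<^sub>v y) $ i = (\<Sum>j<M. A $$ (i, j) * y $ j)"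
  using assms by (simp add: scalar_prod_def atLeast0LessThan)

lemma mat_adjoint_eq_iff:
  assumes "A \<in> carrier_mat N N" "B \<in> carrier_mat N N"
  shows "mat_adjoint A = B \<longleftrightarrow> (\<forall>i<N. \<forall>j<N. cnj (A $$ (j, i)) = B $$ (i, j))"
  using assms by (auto simp: mat_eq_iff mat_adjoint_def mat_of_rows_index)

text \<open>The sign \<open>s\<close> is 1 for Hermitian and -1 for skew-Hermitian matrices, so that
  one argument covers both structures.\<close>

definition sign_Herm :: "complex \<Rightarrow> nat \<Rightarrow> complex mat set" where
  "sign_Herm s N = {A \<in> carrier_mat N N. \<forall>i<N. \<forall>j<N. cnj (A $$ (j, i)) = s * A $$ (i, j)}"

section \<open>Frobenius and spectral norm\<close>

lemma frobenius_norm_L2_set: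
  assumes "A \<in> carrier_mat N N"
  shows "frobenius_norm A = L2_set (\<lambda>p. cmod (A $$ p)) ({..<N} \<times> {..<N})"
  using assms unfolding frobenius_norm_def L2_set_def
  by (auto simp: sum.cartesian_product case_prod_beta)

lemma frobenius_norm_nonneg [simp]: "frobenius_norm A \<ge> 0"
  by (simp add: frobenius_norm_def sum_nonneg)

lemma frobenius_norm_add:
  assumes "A \<in> carrier_mat N N" "B \<in> carrier_mat N N"
  shows "frobenius_norm (A + B) \<le> frobenius_norm A + frobenius_norm B"
proof -
  have "frobenius_norm (A + B)
      \<le> L2_set (\<lambda>p. cmod (A $$ p) + cmod (B $$ p)) ({..<N} \<times> {..<N})"
    using assms
    by (subst frobenius_norm_L2_set[of _ N]) (auto intro!: L2_set_mono norm_triangle_ineq)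
  also have "\<dots> \<le> frobenius_norm A + frobenius_norm B"
    using L2_set_triangle_ineq assms by (simp add: frobenius_norm_L2_set)
  finally show ?thesis .
qed

lemma frobenius_norm_smult:
  "frobenius_norm (c \<cdot>\<^sub>m A) = cmod c * frobenius_norm A"
  by (simp add: frobenius_norm_def norm_mult power_mult_distrib real_sqrt_mult
      flip: sum_distrib_left)

text \<open>Cauchy-Schwarz in every row. The estimate also shows that the set whose
  \<open>Sup\<close> defines \<open>spectral_norm\<close> is bounded above.\<close>

lemma vec_norm2_mult_mat_le_frobenius:
  assumes "A \<in> carrier_mat N N" "y \<in> carrier_vec N"
  shows "vec_norm2 (A *\<^sub>v y) \<le> frobenius_norm A * vec_norm2 y"
proof -
  have *: "cmod ((A *\<^sub>v y) $ i) \<le> L2_set (\<lambda>j. cmod (A $$ (i, j))) {..<N} * vec_norm2 y"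
    if "i < N" for i
  proof -
    have "cmod ((A *\<^sub>v y) $ i) \<le> (\<Sum>j<N. \<bar>cmod (A $$ (i, j))\<bar> * \<bar>cmod (y $ j)\<bar>)"
      unfolding mult_mat_vec_index[OF assms that]
      by (rule order_trans[OF norm_sum]) (simp add: norm_mult)
    also have "\<dots> \<le> L2_set (\<lambda>j. cmod (A $$ (i, j))) {..<N} * vec_norm2 y"
      using L2_set_mult_ineq[of "\<lambda>j. cmod (A $$ (i, j))" "\<lambda>i. cmod (y $ i)" "{..<N}"] assms
      by (simp add: vec_norm2_L2_set)
    finally show ?thesis .
  qed
  have "vec_norm2 (A *\<^sub>v y)
      \<le> L2_set (\<lambda>i. L2_set (\<lambda>j. cmod (A $$ (i, j))) {..<N} * vec_norm2 y) {..<N}"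
    using assms * unfolding vec_norm2_L2_set[of "A *\<^sub>v y"] by (auto intro!: L2_set_mono)
  also have "\<dots> = frobenius_norm A * vec_norm2 y"
    using assms by (simp flip: L2_set_left_distrib)
      (simp add: L2_set_def frobenius_norm_def sum_nonneg)
  finally show ?thesis .
qed

lemma vec_norm2_mult_mat_le_spectral:
  assumes "A \<in> carrier_mat N N" "y \<in> carrier_vec N"
  shows "vec_norm2 (A *\<^sub>v y) \<le> spectral_norm A * vec_norm2 y"
proof (cases "vec_norm2 y = 0")
  case True
  then show ?thesis using vec_norm2_mult_mat_le_frobenius[OF assms] by simp
next
  case False
  define c where "c = vec_norm2 y"
  have c: "c > 0" using False vec_norm2_nonneg[of y] unfolding c_def by linarith
  define z where "z = complex_of_real (1 / c) \<cdot>\<^sub>v y"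
  have z: "z \<in> carrier_vec N" "vec_norm2 z = 1"
    using assms c by (auto simp: z_def vec_norm2_smult norm_divide c_def)
  have "vec_norm2 (A *\<^sub>v z) \<le> spectral_norm A"
    unfolding spectral_norm_def
  proof (rule cSup_upper)
    show "bdd_above {vec_norm2 (A *\<^sub>v x) |x. x \<in> carrier_vec (dim_col A) \<and> vec_norm2 x = 1}"
      using vec_norm2_mult_mat_le_frobenius[OF assms(1)] assms(1)
      by (intro bdd_aboveI[of _ "frobenius_norm A"]) fastforce
  qed (use z assms in auto)
  moreover have "A *\<^sub>v z = complex_of_real (1 / c) \<cdot>\<^sub>v (A *\<^sub>v y)"
    unfolding z_def using assms by (intro mult_mat_vec) auto
  ultimately have "vec_norm2 (A *\<^sub>v y) / c \<le> spectral_norm A"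
    using c by (simp add: vec_norm2_smult norm_divide)
  then show ?thesis using c by (simp add: c_def field_simps)
qed

text \<open>With \<open>N > 0\<close> there is a unit vector, so the set under \<open>Sup\<close> is
  nonempty, as the least upper bound rule demands.\<close>

lemma spectral_norm_le:
  assumes "A \<in> carrier_mat N N" "N > 0"
    and "\<And>y. y \<in> carrier_vec N \<Longrightarrow> vec_norm2 (A *\<^sub>v y) \<le> c * vec_norm2 y"
  shows "spectral_norm A \<le> c"
  unfolding spectral_norm_def
proof (rule cSup_least)
  show "{vec_norm2 (A *\<^sub>v x) |x. x \<in> carrier_vec (dim_col A) \<and> vec_norm2 x = 1} \<noteq> {}"
    using assms(1,2) by (auto intro!: exI[of _ "unit_vec N 0"] vec_norm2_unit_vec)
qed (use assms in fastforce)

lemma spectral_norm_nonneg: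
  assumes "A \<in> carrier_mat N N" "N > 0"
  shows "spectral_norm A \<ge> 0"
proof -
  have "vec_norm2 (A *\<^sub>v unit_vec N 0) \<le> spectral_norm A"
    using vec_norm2_mult_mat_le_spectral[OF assms(1), of "unit_vec N 0"]
      vec_norm2_unit_vec[OF assms(2)] by simp
  then show ?thesis by (rule order_trans[OF vec_norm2_nonneg])
qed

lemma spectral_norm_add:
  assumes "A \<in> carrier_mat N N" "B \<in> carrier_mat N N" "N > 0"
  shows "spectral_norm (A + B) \<le> spectral_norm A + spectral_norm B"
proof (rule spectral_norm_le[of _ N])
  fix y :: "complex vec" assume y: "y \<in> carrier_vec N"
  have "vec_norm2 ((A + B) *\<^sub>v y) \<le> vec_norm2 (A *\<^sub>v y) + vec_norm2 (B *\<^sub>v y)"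
    using assms y by (subst add_mult_distrib_mat_vec) (auto intro!: vec_norm2_add[of _ N])
  also have "\<dots> \<le> (spectral_norm A + spectral_norm B) * vec_norm2 y"
    using vec_norm2_mult_mat_le_spectral assms y by (simp add: distrib_right add_mono)
  finally show "vec_norm2 ((A + B) *\<^sub>v y) \<le> (spectral_norm A + spectral_norm B) * vec_norm2 y" .
qed (use assms in auto)

lemma spectral_norm_smult_le:
  assumes "A \<in> carrier_mat N N" "N > 0"
  shows "spectral_norm (c \<cdot>\<^sub>m A) \<le> cmod c * spectral_norm A"
proof (rule spectral_norm_le[of _ N])
  fix y :: "complex vec" assume y: "y \<in> carrier_vec N"
  have "(c \<cdot>\<^sub>m A) *\<^sub>v y = c \<cdot>\<^sub>v (A *\<^sub>v y)"
    using assms y by auto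
  then show "vec_norm2 ((c \<cdot>\<^sub>m A) *\<^sub>v y) \<le> cmod c * spectral_norm A * vec_norm2 y"
    using vec_norm2_mult_mat_le_spectral[OF assms(1) y]
    by (simp add: vec_norm2_smult mult.assoc mult_left_mono)
qed (use assms in auto)

lemma of_real_cmod_power2: "(complex_of_real (cmod z))\<^sup>2 = z * cnj z"
  by (metis complex_norm_square of_real_power)

lemma sign_Herm_carrier: "A \<in> sign_Herm s N \<Longrightarrow> A \<in> carrier_mat N N"
  by (simp add: sign_Herm_def)

lemma sign_Herm_cinner:
  assumes "A \<in> sign_Herm s N" "s = 1 \<or> s = -1"
  shows "cinner N f (\<lambda>i. \<Sum>j<N. A $$ (i, j) * g j)
    = s * cinner N (\<lambda>i. \<Sum>j<N. A $$ (i, j) * f j) g"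
proof -
  have "cinner N f (\<lambda>i. \<Sum>j<N. A $$ (i, j) * g j)
      = (\<Sum>j<N. \<Sum>i<N. cnj (f i) * A $$ (i, j) * g j)"
    by (subst sum.swap) (simp add: cinner_def sum_distrib_left mult.assoc)
  also have "\<dots> = (\<Sum>j<N. \<Sum>i<N. s * (cnj (A $$ (j, i)) * cnj (f i) * g j))"
    using assms by (intro sum.cong refl) (auto simp: sign_Herm_def)
  also have "\<dots> = s * cinner N (\<lambda>i. \<Sum>j<N. A $$ (i, j) * f j) g"
    by (simp add: cinner_def sum_distrib_left sum_distrib_right mult.assoc)
  finally show ?thesis .
qed

text \<open>This yields the necessary condition \<open>cnj a = s * a\<close> on
  \<open>a = \<langle>u, r\<rangle>\<close> for a structured solution of \<open>A u = r\<close>. For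
  unit \<open>u\<close> the two extremal matrices below show that it is also sufficient.\<close>

lemma sign_Herm_quadratic_form:
  assumes "A \<in> sign_Herm s N" "s = 1 \<or> s = -1" "u \<in> carrier_vec N"
  shows "cnj (cinner N (($) u) (($) (A *\<^sub>v u))) = s * cinner N (($) u) (($) (A *\<^sub>v u))"
proof -
  have *: "cinner N (($) u) (($) (A *\<^sub>v u)) = cinner N (($) u) (\<lambda>i. \<Sum>j<N. A $$ (i, j) * u $ j)"
    "cinner N (($) (A *\<^sub>v u)) (($) u) = cinner N (\<lambda>i. \<Sum>j<N. A $$ (i, j) * u $ j) (($) u)"
    using assms sign_Herm_carrier[OF assms(1)]
    by (auto intro!: cinner_cong simp: mult_mat_vec_index[of _ N N] simp del: index_mult_mat_vec)
  then show ?thesis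
    using sign_Herm_cinner[OF assms(1,2), of "($) u" "($) u"] assms(2) 
    by (auto simp: cnj_cinner)
qed

section \<open>Minimal structured solutions of \<open>E u = r\<close>\<close>

text \<open>
  Every admissible \<open>A\<close> has the same Frobenius inner product with this matrix, which is therefore
  the orthogonal projection of \<open>0\<close> onto the affine space of admissible matrices.
\<close>

definition frobenius_extremal :: "complex \<Rightarrow> nat \<Rightarrow> complex vec \<Rightarrow> complex vec \<Rightarrow> complex mat" where
  "frobenius_extremal s N u r = mat N N (\<lambda>(i, j). r $ i * cnj (u $ j) + s * u $ i * cnj (r $ j)
     - cinner N (($) u) (($) r) * u $ i * cnj (u $ j))"

text \<open>
  On the span of the orthogonal vectors \<open>u\<close> and \<open>b = r - a u\<close> this matrix is a multiple of a unitary
  one, and it vanishes on the orthogonal complement. If \<open>b = 0\<close>, the quotient is \<open>0\<close>.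
\<close>

definition spectral_extremal :: "complex \<Rightarrow> nat \<Rightarrow> complex vec \<Rightarrow> complex vec \<Rightarrow> complex mat" where
  "spectral_extremal s N u r =
     (let a = cinner N (($) u) (($) r); b = (\<lambda>i. r $ i - a * u $ i) in
      mat N N (\<lambda>(i, j). a * u $ i * cnj (u $ j) + b i * cnj (u $ j) + s * u $ i * cnj (b j)
        - a / cinner N b b * b i * cnj (b j)))"

context
  fixes s :: complex and N :: nat and u r :: "complex vec" and a :: complex
  assumes s: "s = 1 \<or> s = -1"
    and u: "u \<in> carrier_vec N" "vec_norm2 u = 1"
    and r: "r \<in> carrier_vec N"
    and a_def: "a = cinner N (($) u) (($) r)"
    and a: "cnj a = s * a"
begin

section \<open>The solution of least Frobenius norm\<close>

lemma uu: "cinner N (($) u) (($) u) = 1"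
  using cinner_vec_norm2[OF u(1)] u(2) by simp

lemma ru: "cinner N (($) r) (($) u) = s * a"
  using a cnj_cinner[of N "($) u" "($) r"] by (simp add: a_def)

lemma frobenius_extremal_sign_Herm: "frobenius_extremal s N u r \<in> sign_Herm s N"
  using s a by (auto simp: sign_Herm_def frobenius_extremal_def algebra_simps simp flip: a_def)

lemma frobenius_extremal_mult: "frobenius_extremal s N u r *\<^sub>v u = r"
proof (rule eq_vecI)
  fix i assume i: "i < dim_vec r"
  then have "(frobenius_extremal s N u r *\<^sub>v u) $ i
      = (\<Sum>j<N. frobenius_extremal s N u r $$ (i, j) * u $ j)"
    using u r by (intro mult_mat_vec_index) (auto simp: frobenius_extremal_def)
  also have "\<dots> = r $ i * cinner N (($) u) (($) u) + s * u $ i * cinner N (($) r) (($) u)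
      - a * u $ i * cinner N (($) u) (($) u)"
    using i r unfolding cinner_def[of N _ "($) u"]
    by (simp add: frobenius_extremal_def sum_distrib_left algebra_simps sum.distrib
        sum_subtractf flip: a_def)
  \<comment> \<open>The last two terms are \<open>s * s * a * u $ i\<close> and
    \<open>a * u $ i\<close>; they cancel because \<open>s * s = 1\<close>.\<close>
  also have "\<dots> = r $ i"
    using s by (auto simp: uu ru)
  finally show "(frobenius_extremal s N u r *\<^sub>v u) $ i = r $ i" .
qed (use r in \<open>auto simp: frobenius_extremal_def\<close>)

text \<open>Each rank-one term of the extremal matrix has \<open>u\<close> on one side, so its inner
  product with \<open>A\<close> involves \<open>A\<close> only through \<open>A u = r\<close>. In
  the term with \<open>u\<close> on the left, \<open>A\<close> is first moved to the other argument,
  and the resulting \<open>s\<close> cancels against \<open>cnj s\<close>.\<close>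

lemma inner_frobenius_extremal:
  assumes "A \<in> sign_Herm s N" "A *\<^sub>v u = r"
  shows "(\<Sum>i<N. \<Sum>j<N. cnj (frobenius_extremal s N u r $$ (i, j)) * A $$ (i, j))
    = of_real (2 * (vec_norm2 r)\<^sup>2 - (cmod a)\<^sup>2)"
proof -
  define f where "f = (\<lambda>g i. \<Sum>j<N. A $$ (i, j) * g j)"
  have fu: "f (($) u) i = r $ i" if "i < N" for i
    using mult_mat_vec_index[OF sign_Herm_carrier[OF assms(1)] u(1) that] assms(2)
    by (simp add: f_def)
  have "(\<Sum>i<N. \<Sum>j<N. cnj (frobenius_extremal s N u r $$ (i, j)) * A $$ (i, j))
      = cinner N (($) r) (f (($) u)) + cnj s * cinner N (($) u) (f (($) r))
        - cnj a * cinner N (($) u) (f (($) u))"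
    unfolding cinner_def f_def
    by (simp add: frobenius_extremal_def sum_distrib_left algebra_simps sum.distrib
        sum_subtractf flip: a_def)
  also have "cinner N (($) u) (f (($) r)) = s * cinner N (f (($) u)) (($) r)"
    unfolding f_def by (rule sign_Herm_cinner[OF assms(1) s])
  also have "cinner N (f (($) u)) (($) r) = cinner N (($) r) (($) r)"
    by (rule cinner_cong) (auto simp: fu)
  also have "cinner N (($) r) (f (($) u)) = cinner N (($) r) (($) r)"
    by (rule cinner_cong) (auto simp: fu)
  also have "cinner N (($) u) (f (($) u)) = a"
    unfolding a_def by (rule cinner_cong) (auto simp: fu)
  finally show ?thesis
    using s by (auto simp: cinner_vec_norm2[OF r] of_real_cmod_power2 mult.commute)
qed

lemma frobenius_norm_extremal:
  "(frobenius_norm (frobenius_extremal s N u r))\<^sup>2 = 2 * (vec_norm2 r)\<^sup>2 - (cmod a)\<^sup>2"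
proof -
  let ?R = "frobenius_extremal s N u r"
  have "complex_of_real ((frobenius_norm ?R)\<^sup>2) = (\<Sum>i<N. \<Sum>j<N. cnj (?R $$ (i, j)) * ?R $$ (i, j))"
    using sign_Herm_carrier[OF frobenius_extremal_sign_Herm]
    by (auto simp: frobenius_norm_def sum_nonneg complex_norm_square mult.commute
        simp del: of_real_power)
  also have "\<dots> = of_real (2 * (vec_norm2 r)\<^sup>2 - (cmod a)\<^sup>2)"
    by (rule inner_frobenius_extremal[OF frobenius_extremal_sign_Herm frobenius_extremal_mult])
  finally show ?thesis using of_real_eq_iff by blast
qed

text \<open>Pythagoras: the inner product of \<open>A\<close> with the extremal matrix
  \<open>R\<close> equals the squared norm of \<open>R\<close>, so the squared norm of
  \<open>A - R\<close> is the difference of the squared norms.\<close>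

lemma frobenius_norm_ge:
  assumes "A \<in> sign_Herm s N" "A *\<^sub>v u = r"
  shows "sqrt (2 * (vec_norm2 r)\<^sup>2 - (cmod a)\<^sup>2) \<le> frobenius_norm A"
proof -
  let ?R = "frobenius_extremal s N u r" and ?K = "2 * (vec_norm2 r)\<^sup>2 - (cmod a)\<^sup>2"
  have A: "A \<in> carrier_mat N N" and R: "?R \<in> carrier_mat N N"
    using assms(1) frobenius_extremal_sign_Herm by (auto simp: sign_Herm_def)
  have *: "(cmod (z - w))\<^sup>2 = (cmod z)\<^sup>2 + (cmod w)\<^sup>2 - 2 * Re (cnj w * z)" for z w
    unfolding cmod_power2 by (simp add: power2_eq_square algebra_simps)
  have "0 \<le> (\<Sum>i<N. \<Sum>j<N. (cmod (A $$ (i, j) - ?R $$ (i, j)))\<^sup>2)"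
    by (intro sum_nonneg) auto
  also have "\<dots> = (frobenius_norm A)\<^sup>2 + (frobenius_norm ?R)\<^sup>2
      - 2 * Re (\<Sum>i<N. \<Sum>j<N. cnj (?R $$ (i, j)) * A $$ (i, j))"
    using A R unfolding * frobenius_norm_def
    by (simp add: sum_nonneg sum.distrib sum_subtractf sum_distrib_left)
  also have "\<dots> = (frobenius_norm A)\<^sup>2 - ?K"
    unfolding inner_frobenius_extremal[OF assms] frobenius_norm_extremal by simp
  finally show ?thesis by (intro real_le_lsqrt) auto
qed

section \<open>A solution of least spectral norm\<close>

lemma spectral_extremal_sign_Herm: "spectral_extremal s N u r \<in> sign_Herm s N"
  using s a by (auto simp: sign_Herm_def spectral_extremal_def Let_def cnj_cinner
      algebra_simps simp flip: a_def)

lemma spectral_extremal_mult_index: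
  fixes y :: "complex vec"
  defines "b \<equiv> (\<lambda>i. r $ i - a * u $ i)"
  defines "p \<equiv> cinner N (($) u) (($) y)" and "q \<equiv> cinner N b (($) y)"
  assumes y: "y \<in> carrier_vec N" and i: "i < N"
  shows "(spectral_extremal s N u r *\<^sub>v y) $ i
    = (a * p + s * q) * u $ i + (p - a / cinner N b b * q) * b i"
proof -
  define c where "c = a / cinner N b b"
  have "(spectral_extremal s N u r *\<^sub>v y) $ i
      = (\<Sum>j<N. spectral_extremal s N u r $$ (i, j) * y $ j)"
    using i y by (intro mult_mat_vec_index) (auto simp: spectral_extremal_def Let_def)
  also have "\<dots> = (\<Sum>j<N. a * u $ i * (cnj (u $ j) * y $ j) + b i * (cnj (u $ j) * y $ j)
      + s * u $ i * (cnj (b j) * y $ j) - c * b i * (cnj (b j) * y $ j))"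
    using i unfolding c_def b_def
    by (intro sum.cong refl)
      (simp add: spectral_extremal_def Let_def algebra_simps flip: a_def)
  also have "\<dots> = a * u $ i * p + b i * p + s * u $ i * q - c * b i * q"
    unfolding p_def q_def cinner_def sum_distrib_left by (simp add: sum.distrib sum_subtractf)
  finally show ?thesis by (simp add: c_def algebra_simps)
qed

lemma spectral_extremal_mult: "spectral_extremal s N u r *\<^sub>v u = r"
proof (rule eq_vecI)
  fix i assume i: "i < dim_vec r"
  \<comment> \<open>Orthogonality of \<open>b\<close> and \<open>u\<close> makes
    \<open>q = 0\<close> and \<open>p = 1\<close> at \<open>y = u\<close>, leaving
    \<open>a u + b = r\<close>.\<close>
  have "cinner N (\<lambda>i. r $ i - a * u $ i) (($) u) = 0"
    using a by (simp add: cinner_simps uu ru)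
  then show "(spectral_extremal s N u r *\<^sub>v u) $ i = r $ i"
    using i r by (simp add: spectral_extremal_mult_index[OF u(1)] uu del: index_mult_mat_vec)
qed (use r in \<open>auto simp: spectral_extremal_def Let_def\<close>)

text \<open>For \<open>b \<noteq> 0\<close> and \<open>\<beta> = \<parallel>b\<parallel>\<close>,
  the matrix acts on the orthonormal basis \<open>u\<close>, \<open>b / \<beta>\<close> with rows
  \<open>(a, s \<beta>)\<close> and \<open>(\<beta>, -a)\<close>. Its columns are orthogonal because
  \<open>cnj a = s * a\<close>, and both have norm \<open>\<parallel>r\<parallel>\<close>.\<close>

lemma spectral_norm_extremal_le:
  assumes "N > 0"
  shows "spectral_norm (spectral_extremal s N u r) \<le> vec_norm2 r"
proof (rule spectral_norm_le[of _ N])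
  let ?R = "spectral_extremal s N u r"
  show R: "?R \<in> carrier_mat N N" by (rule sign_Herm_carrier[OF spectral_extremal_sign_Herm])
  fix y :: "complex vec" assume y: "y \<in> carrier_vec N"
  define b where "b = (\<lambda>i. r $ i - a * u $ i)"
  define B where "B = (\<Sum>i<N. (cmod (b i))\<^sup>2)"
  define p q t where "p = cinner N (($) u) (($) y)" and "q = cinner N b (($) y)" and "t = q / B"
  have bb: "cinner N b b = of_real B" by (simp add: cinner_self B_def)
  have bu: "cinner N b (($) u) = 0"
    using a by (simp add: b_def cinner_simps uu ru)
  have ub: "cinner N (($) u) b = 0"
    using cnj_cinner[of N b "($) u"] bu by simp
  have B: "B \<ge> 0" by (simp add: B_def sum_nonneg)
  \<comment> \<open>If \<open>B = 0\<close>, then \<open>t = 0\<close> by the convention for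
    division, and \<open>q = 0\<close> since \<open>b\<close> vanishes; so no case distinction is
    needed afterwards.\<close>
  have q: "q = B * t"
  proof (cases "B = 0")
    case True
    then have "\<forall>i<N. b i = 0" by (auto simp: B_def sum_nonneg_eq_0_iff)
    then show ?thesis using True by (simp add: q_def cinner_def)
  qed (simp add: t_def)
  have yu: "cinner N (($) y) (($) u) = cnj p" and yb: "cinner N (($) y) b = cnj q"
    by (simp_all add: p_def q_def cnj_cinner)
  have "complex_of_real ((vec_norm2 r)\<^sup>2) = cinner N (\<lambda>i. b i + a * u $ i) (\<lambda>i. b i + a * u $ i)"
    using cinner_vec_norm2[OF r] by (simp add: b_def)
  also have "\<dots> = of_real (B + (cmod a)\<^sup>2)"
    by (simp add: cinner_simps bb bu ub uu of_real_cmod_power2 mult.commute)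
  finally have rho: "(vec_norm2 r)\<^sup>2 = B + (cmod a)\<^sup>2" using of_real_eq_iff by blast
  have "complex_of_real ((vec_norm2 (?R *\<^sub>v y))\<^sup>2) = cinner N (($) (?R *\<^sub>v y)) (($) (?R *\<^sub>v y))"
    using R y by (subst cinner_vec_norm2) auto
  also have "\<dots> = cinner N (\<lambda>i. (a * p + s * q) * u $ i + (p - a * t) * b i)
      (\<lambda>i. (a * p + s * q) * u $ i + (p - a * t) * b i)"
    using y by (intro cinner_cong) 
      (simp_all add: spectral_extremal_mult_index p_def q_def t_def b_def bb[unfolded b_def]
        del: index_mult_mat_vec)
  also have "\<dots> = cnj (a * p + s * q) * (a * p + s * q) + cnj (p - a * t) * (p - a * t) * B"
    by (simp add: cinner_simps bb bu ub uu)
  \<comment> \<open>The mixed terms in \<open>p\<close> and \<open>t\<close> cancel by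
    \<open>cnj a = s * a\<close> and \<open>s * s = 1\<close>.\<close>
  also have "\<dots> = (B + cnj a * a) * (cnj p * p + B * (cnj t * t))"
    using s a unfolding q by (elim disjE) (simp_all add: algebra_simps)
  also have "\<dots> = of_real ((vec_norm2 r)\<^sup>2 * ((cmod p)\<^sup>2 + B * (cmod t)\<^sup>2))"
    unfolding rho by (simp add: of_real_cmod_power2 mult.commute)
  finally have *: "(vec_norm2 (?R *\<^sub>v y))\<^sup>2 = (vec_norm2 r)\<^sup>2 * ((cmod p)\<^sup>2 + B * (cmod t)\<^sup>2)"
    using of_real_eq_iff by blast
  \<comment> \<open>Bessel's inequality for the orthogonal pair \<open>u\<close>, \<open>b\<close>\<close>
  have "0 \<le> Re (cinner N (\<lambda>i. y $ i - p * u $ i - t * b i) (\<lambda>i. y $ i - p * u $ i - t * b i))"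
    by (simp add: cinner_self sum_nonneg)
  also have "cinner N (\<lambda>i. y $ i - p * u $ i - t * b i) (\<lambda>i. y $ i - p * u $ i - t * b i)
      = of_real ((vec_norm2 y)\<^sup>2) - cnj p * p - B * (cnj t * t)"
    by (simp only: cinner_simps bb bu ub uu yu yb cinner_vec_norm2[OF y] flip: p_def q_def)
      (simp add: q algebra_simps)
  also have "\<dots> = of_real ((vec_norm2 y)\<^sup>2 - (cmod p)\<^sup>2 - B * (cmod t)\<^sup>2)"
    by (simp add: of_real_cmod_power2 mult.commute)
  finally have "(cmod p)\<^sup>2 + B * (cmod t)\<^sup>2 \<le> (vec_norm2 y)\<^sup>2" by simp
  then have "(vec_norm2 (?R *\<^sub>v y))\<^sup>2 \<le> (vec_norm2 r * vec_norm2 y)\<^sup>2"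
    unfolding * power_mult_distrib by (intro mult_left_mono) auto
  then show "vec_norm2 (?R *\<^sub>v y) \<le> vec_norm2 r * vec_norm2 y"
    by (rule power2_le_imp_le) simp
qed (fact assms)

lemma spectral_norm_ge:
  assumes "A \<in> sign_Herm s N" "A *\<^sub>v u = r"
  shows "vec_norm2 r \<le> spectral_norm A"
  using vec_norm2_mult_mat_le_spectral[OF sign_Herm_carrier[OF assms(1)] u(1)] assms(2) u(2)
  by simp

end

section \<open>Backward errors at real points\<close>

definition sign_Herm_polys :: "complex \<Rightarrow> nat \<Rightarrow> nat \<Rightarrow> complex poly mat set" where
  "sign_Herm_polys s k N = {Q \<in> mat_polys k N. \<forall>j\<le>k. mat_coeff Q j \<in> sign_Herm s N}"

lemma mat_coeff_carrier [simp]: "Q \<in> carrier_mat N M \<Longrightarrow> mat_coeff Q j \<in> carrier_mat N M"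
  by (simp add: mat_coeff_def)

lemma mat_eval_carrier [simp]: "Q \<in> carrier_mat N M \<Longrightarrow> mat_eval Q z \<in> carrier_mat N M"
  by (simp add: mat_eval_def)

lemma mat_polys_carrier: "Q \<in> mat_polys k N \<Longrightarrow> Q \<in> carrier_mat N N"
  by (simp add: mat_polys_def)

lemma Herm_eq_sign_Herm_polys: "Herm k N = sign_Herm_polys 1 k N"
proof -
  have "mat_adjoint (mat_coeff Q j) = mat_coeff Q j \<longleftrightarrow> mat_coeff Q j \<in> sign_Herm 1 N"
    if "Q \<in> mat_polys k N" for Q j
    using mat_polys_carrier[OF that] mat_adjoint_eq_iff[of "mat_coeff Q j" N "mat_coeff Q j"]
    by (simp add: sign_Herm_def)
  then show ?thesis unfolding Herm_def sign_Herm_polys_def by blast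
qed

lemma skew_Herm_eq_sign_Herm_polys: "skew_Herm k N = sign_Herm_polys (-1) k N"
proof -
  have "mat_adjoint (mat_coeff Q j) = - mat_coeff Q j \<longleftrightarrow> mat_coeff Q j \<in> sign_Herm (-1) N"
    if "Q \<in> mat_polys k N" for Q j
    using mat_polys_carrier[OF that] mat_adjoint_eq_iff[of "mat_coeff Q j" N "- mat_coeff Q j"]
    by (auto simp: sign_Herm_def mat_coeff_def)
  then show ?thesis unfolding skew_Herm_def sign_Herm_polys_def by blast
qed

section \<open>Values of matrix polynomials against their coefficients\<close>

lemma mat_eval_index:
  assumes "Q \<in> mat_polys k N" "i < N" "j < N"
  shows "mat_eval Q z $$ (i, j) = (\<Sum>l\<le>k. z ^ l * mat_coeff Q l $$ (i, j))"
proof -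
  \<comment> \<open>The entry may have degree below the grade \<open>k\<close>; the added
    coefficients are zero.\<close>
  have "poly (Q $$ (i, j)) z = (\<Sum>l\<le>k. coeff (Q $$ (i, j)) l * z ^ l)"
    unfolding poly_altdef using assms
    by (intro sum.mono_neutral_left) (auto simp: mat_polys_def coeff_eq_0)
  then show ?thesis
    using assms mat_polys_carrier[OF assms(1)]
    by (simp add: mat_eval_def mat_coeff_def mult.commute)
qed

text \<open>Conjugation fixes the powers of a real \<open>z\<close>, so the value inherits the
  structure of the coefficients.\<close>

lemma mat_eval_sign_Herm:
  assumes "Q \<in> sign_Herm_polys s k N" "z \<in> \<real>"
  shows "mat_eval Q z \<in> sign_Herm s N"
proof -
  have Q: "Q \<in> mat_polys k N" using assms by (simp add: sign_Herm_polys_def)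
  have "cnj z = z" using assms by (simp add: Reals_cnj_iff)
  then have "cnj (mat_eval Q z $$ (j, i)) = s * mat_eval Q z $$ (i, j)" if "i < N" "j < N" for i j
    using assms that unfolding mat_eval_index[OF Q that] mat_eval_index[OF Q that(2,1)]
    by (auto simp: sign_Herm_polys_def sign_Herm_def sum_distrib_left mult_ac intro!: sum.cong)
  then show ?thesis using mat_polys_carrier[OF Q] by (simp add: sign_Herm_def)
qed

text \<open>Triangle inequality over the coefficients, then Cauchy-Schwarz in the coefficient index.
  The norm stays abstract so that the Frobenius and spectral cases share the argument.\<close>

lemma nrm_mat_eval_le:
  fixes nrm :: "complex mat \<Rightarrow> real"
  assumes add: "\<And>A B. A \<in> carrier_mat N N \<Longrightarrow> B \<in> carrier_mat N N \<Longrightarrow> nrm (A + B) \<le> nrm A + nrm B"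
    and smult: "\<And>c A. A \<in> carrier_mat N N \<Longrightarrow> nrm (c \<cdot>\<^sub>m A) \<le> cmod c * nrm A"
    and Q: "Q \<in> mat_polys k N"
  shows "nrm (mat_eval Q z) \<le> sqrt (\<Sum>j\<le>k. (cmod z) ^ (2 * j)) * mat_poly_norm nrm k Q"
proof -
  \<comment> \<open>Partial sums of the value at \<open>z\<close>, which let the triangle inequality
    run by induction on \<open>l\<close>.\<close>
  define M where "M = (\<lambda>l. mat N N (\<lambda>(i, j). \<Sum>h\<le>l. z ^ h * mat_coeff Q h $$ (i, j)))"
  have QC: "mat_coeff Q l \<in> carrier_mat N N" for l using mat_polys_carrier[OF Q] by simp
  have "nrm (M l) \<le> (\<Sum>h\<le>l. cmod z ^ h * nrm (mat_coeff Q h))" for l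
  proof (induction l)
    case 0
    have "M 0 = 1 \<cdot>\<^sub>m mat_coeff Q 0" using QC[of 0] by (auto simp: M_def)
    then show ?case using smult[OF QC, of 1 0] by simp
  next
    case (Suc l)
    have "M (Suc l) = M l + z ^ Suc l \<cdot>\<^sub>m mat_coeff Q (Suc l)"
      using QC[of "Suc l"] by (auto simp: M_def)
    then have "nrm (M (Suc l)) \<le> nrm (M l) + nrm (z ^ Suc l \<cdot>\<^sub>m mat_coeff Q (Suc l))"
      using add[of "M l" "z ^ Suc l \<cdot>\<^sub>m mat_coeff Q (Suc l)"] QC by (simp add: M_def)
    also have "nrm (z ^ Suc l \<cdot>\<^sub>m mat_coeff Q (Suc l)) \<le> cmod z ^ Suc l * nrm (mat_coeff Q (Suc l))"
      using smult[OF QC] by (metis norm_power)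
    finally show ?case using Suc.IH by simp
  qed
  moreover have "mat_eval Q z = M k"
    using mat_eval_index[OF Q] mat_polys_carrier[OF Q] by (auto simp: M_def mat_eval_def)
  ultimately have "nrm (mat_eval Q z) \<le> (\<Sum>h\<le>k. cmod z ^ h * nrm (mat_coeff Q h))"
    by simp
  also have "\<dots> \<le> (\<Sum>h\<le>k. \<bar>cmod z ^ h\<bar> * \<bar>nrm (mat_coeff Q h)\<bar>)"
    by (intro sum_mono) (simp add: mult_left_mono)
  also have "\<dots> \<le> sqrt (\<Sum>j\<le>k. (cmod z) ^ (2 * j)) * mat_poly_norm nrm k Q"
    using L2_set_mult_ineq[of "\<lambda>h. cmod z ^ h" "\<lambda>h. nrm (mat_coeff Q h)" "{..k}"]
    by (simp add: L2_set_def mat_poly_norm_def power_even_eq)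
  finally show ?thesis .
qed

text \<open>The summand for \<open>j = 0\<close> is 1, also when \<open>t = 0\<close>.\<close>

lemma sum_even_powers_pos: "(\<Sum>j\<le>k. (t::real) ^ (2 * j)) > 0"
proof -
  have "(\<Sum>j\<in>{0::nat}. t ^ (2 * j)) \<le> (\<Sum>j\<le>k. t ^ (2 * j))"
    by (intro sum_mono2) auto
  then show ?thesis by simp
qed

text \<open>The shares \<open>t ^ l / w\<close> are the equality case of Cauchy-Schwarz in
  \<open>nrm_mat_eval_le\<close>. They are real, so every coefficient keeps the structure of
  \<open>E\<close>, and at \<open>t\<close> the values \<open>t ^ l * (t ^ l / w)\<close> add up to
  1.\<close>

lemma spread_matrix_over_coefficients:
  fixes nrm :: "complex mat \<Rightarrow> real" and t :: real
  assumes smult: "\<And>c A. A \<in> carrier_mat N N \<Longrightarrow> nrm (c \<cdot>\<^sub>m A) \<le> cmod c * nrm A"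
    and nonneg: "\<And>A. A \<in> carrier_mat N N \<Longrightarrow> 0 \<le> nrm A"
    and E: "E \<in> sign_Herm s N"
  obtains D where "D \<in> sign_Herm_polys s k N" "mat_eval D (of_real t) = E"
    "mat_poly_norm nrm k D \<le> nrm E / sqrt (\<Sum>j\<le>k. t ^ (2 * j))"
proof -
  define w where "w = (\<Sum>j\<le>k. t ^ (2 * j))"
  have w: "w > 0" unfolding w_def by (rule sum_even_powers_pos)
  define D where "D = mat N N (\<lambda>(i, j). \<Sum>l\<le>k. monom (of_real (t ^ l / w) * E $$ (i, j)) l)"
  have EC: "E \<in> carrier_mat N N" using E by (rule sign_Herm_carrier)
  have coeff: "mat_coeff D l = of_real (t ^ l / w) \<cdot>\<^sub>m E" if "l \<le> k" for l
    using EC that by (auto simp: mat_coeff_def D_def coeff_sum if_distrib cong: if_cong)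
  have D: "D \<in> mat_polys k N"
    by (auto simp: mat_polys_def D_def intro!: degree_sum_le order_trans[OF degree_monom_le])
  have "D \<in> sign_Herm_polys s k N"
    using D E by (auto simp: sign_Herm_polys_def coeff sign_Herm_def)
  moreover have "mat_eval D (of_real t) = E"
  proof (rule eq_matI)
    fix i j assume ij: "i < dim_row E" "j < dim_col E"
    then have "mat_eval D (of_real t) $$ (i, j)
        = (\<Sum>l\<le>k. of_real t ^ l * (of_real (t ^ l / w) * E $$ (i, j)))"
      using EC by (subst mat_eval_index[OF D]) (auto simp: coeff)
    also have "\<dots> = of_real ((\<Sum>l\<le>k. t ^ (2 * l)) / w) * E $$ (i, j)"
      by (simp add: sum_distrib_right sum_divide_distrib power_even_eq power2_eq_square
          power_mult_distrib mult.assoc)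
    also have "\<dots> = E $$ (i, j)" using w by (simp flip: w_def)
    finally show "mat_eval D (of_real t) $$ (i, j) = E $$ (i, j)" .
  qed (use EC in \<open>auto simp: mat_eval_def D_def\<close>)
  moreover have "mat_poly_norm nrm k D \<le> nrm E / sqrt w"
  proof -
    have "(\<Sum>l\<le>k. (nrm (mat_coeff D l))\<^sup>2) \<le> (\<Sum>l\<le>k. (\<bar>t ^ l / w\<bar> * nrm E)\<^sup>2)"
    proof (rule sum_mono)
      fix l assume "l \<in> {..k}"
      then show "(nrm (mat_coeff D l))\<^sup>2 \<le> (\<bar>t ^ l / w\<bar> * nrm E)\<^sup>2"
        using smult[OF EC, of "of_real (t ^ l / w)"] nonneg[of "of_real (t ^ l / w) \<cdot>\<^sub>m E"] EC
        by (intro power_mono) (auto simp: coeff norm_divide norm_power abs_mult power_abs)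
    qed
    also have "\<dots> = (\<Sum>l\<le>k. t ^ (2 * l)) * (nrm E)\<^sup>2 / w\<^sup>2"
      by (simp add: power_mult_distrib power_divide sum_distrib_right sum_divide_distrib
          power_even_eq)
    also have "\<dots> = (nrm E / sqrt w)\<^sup>2"
      using w by (simp add: power_divide power2_eq_square flip: w_def)
    finally show ?thesis
      unfolding mat_poly_norm_def using w nonneg[OF EC] by (intro real_le_lsqrt) (auto intro: sum_nonneg)
  qed
  ultimately show thesis using that by (simp add: w_def)
qed

text \<open>Turns the infimum over polynomials into a least norm \<open>\<mu>\<close> over matrices.
  Evaluation at \<open>t\<close> bounds every admissible norm from below, and spreading a minimal
  \<open>E\<close> over the coefficients attains the bound.\<close>

lemma backward_error_eq_min:
  fixes nrm :: "complex mat \<Rightarrow> real" and t :: real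
  assumes add: "\<And>A B. A \<in> carrier_mat N N \<Longrightarrow> B \<in> carrier_mat N N \<Longrightarrow> nrm (A + B) \<le> nrm A + nrm B"
    and smult: "\<And>c A. A \<in> carrier_mat N N \<Longrightarrow> nrm (c \<cdot>\<^sub>m A) \<le> cmod c * nrm A"
    and nonneg: "\<And>A. A \<in> carrier_mat N N \<Longrightarrow> 0 \<le> nrm A"
    and Q: "Q \<in> carrier_mat N N" and u: "u \<in> carrier_vec N"
    and lower: "\<And>E. E \<in> sign_Herm s N \<Longrightarrow> E *\<^sub>v u = - (mat_eval Q (of_real t) *\<^sub>v u) \<Longrightarrow> \<mu> \<le> nrm E"
    and E: "E \<in> sign_Herm s N" "E *\<^sub>v u = - (mat_eval Q (of_real t) *\<^sub>v u)" "nrm E \<le> \<mu>"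
  shows "backward_error nrm (sign_Herm_polys s k N) k (of_real t) u Q
    = \<mu> / sqrt (\<Sum>j\<le>k. t ^ (2 * j))"
proof -
  define w where "w = (\<Sum>j\<le>k. t ^ (2 * j))"
  define X where "X = {mat_poly_norm nrm k D | D. D \<in> sign_Herm_polys s k N \<and>
    mat_eval Q (of_real t) *\<^sub>v u + mat_eval D (of_real t) *\<^sub>v u = 0\<^sub>v (dim_row Q)}"
  have w: "w > 0" unfolding w_def by (rule sum_even_powers_pos)
  have Qu: "mat_eval Q (of_real t) *\<^sub>v u \<in> carrier_vec N"
    using Q u by (intro mult_mat_vec_carrier[of _ N N]) auto
  have ge: "\<mu> / sqrt w \<le> mat_poly_norm nrm k D"
    if D: "D \<in> sign_Herm_polys s k N"
      and eq: "mat_eval Q (of_real t) *\<^sub>v u + mat_eval D (of_real t) *\<^sub>v u = 0\<^sub>v (dim_row Q)" for D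
  proof -
    have DP: "D \<in> mat_polys k N" using D by (simp add: sign_Herm_polys_def)
    have Du: "mat_eval D (of_real t) *\<^sub>v u \<in> carrier_vec N"
      using mat_polys_carrier[OF DP] u by (intro mult_mat_vec_carrier[of _ N N]) auto
    have "mat_eval D (of_real t) *\<^sub>v u = - (mat_eval Q (of_real t) *\<^sub>v u)"
      using vec_add_eq_0[OF Qu Du] eq Q by simp
    then have "\<mu> \<le> nrm (mat_eval D (of_real t))"
      by (intro lower mat_eval_sign_Herm[OF D]) auto
    also have "\<dots> \<le> sqrt (\<Sum>j\<le>k. (cmod (of_real t)) ^ (2 * j)) * mat_poly_norm nrm k D"
      by (rule nrm_mat_eval_le[OF add smult DP])
    also have "(\<Sum>j\<le>k. (cmod (of_real t)) ^ (2 * j)) = w"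
      by (simp add: w_def power_mult)
    finally show ?thesis using w by (simp add: field_simps)
  qed
  obtain D where D: "D \<in> sign_Herm_polys s k N" "mat_eval D (of_real t) = E"
    "mat_poly_norm nrm k D \<le> nrm E / sqrt w"
    using spread_matrix_over_coefficients[OF smult nonneg E(1)] unfolding w_def by blast
  have eq: "mat_eval Q (of_real t) *\<^sub>v u + mat_eval D (of_real t) *\<^sub>v u = 0\<^sub>v (dim_row Q)"
    using D(2) E(2) Qu Q by simp
  have "mat_poly_norm nrm k D \<le> \<mu> / sqrt w"
    using D(3) E(3) w by (meson divide_right_mono order_trans real_sqrt_ge_zero less_imp_le)
  with ge[OF D(1) eq] have "\<mu> / sqrt w = mat_poly_norm nrm k D" by simp
  with D(1) eq have "\<mu> / sqrt w \<in> X" unfolding X_def by blast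
  then have "Inf X = \<mu> / sqrt w" by (rule cInf_eq_minimum) (auto simp: X_def ge)
  then show ?thesis by (simp add: backward_error_def X_def w_def)
qed

text \<open>The constraint is homogeneous in \<open>u\<close>. This permits normalizing
  \<open>\<Lambda> \<otimes> x\<close>, since the minimal solutions above are for unit
  vectors.\<close>

lemma backward_error_smult:
  assumes "c \<noteq> 0" "u \<in> carrier_vec N" "Q \<in> carrier_mat N N" "S \<subseteq> mat_polys k N"
  shows "backward_error nrm S k lam (c \<cdot>\<^sub>v u) Q = backward_error nrm S k lam u Q"
proof -
  have "mat_eval Q lam *\<^sub>v (c \<cdot>\<^sub>v u) + mat_eval D lam *\<^sub>v (c \<cdot>\<^sub>v u) = 0\<^sub>v (dim_row Q) \<longleftrightarrow>
      mat_eval Q lam *\<^sub>v u + mat_eval D lam *\<^sub>v u = 0\<^sub>v (dim_row Q)" if "D \<in> S" for D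
  proof -
    have "D \<in> carrier_mat N N" using that assms mat_polys_carrier by blast
    then have "mat_eval Q lam *\<^sub>v (c \<cdot>\<^sub>v u) = c \<cdot>\<^sub>v (mat_eval Q lam *\<^sub>v u)"
      "mat_eval D lam *\<^sub>v (c \<cdot>\<^sub>v u) = c \<cdot>\<^sub>v (mat_eval D lam *\<^sub>v u)"
      "mat_eval Q lam \<in> carrier_mat N N" "mat_eval D lam \<in> carrier_mat N N"
      using assms mult_mat_vec mat_eval_carrier by blast+
    then show ?thesis
      using assms by (auto simp: vec_eq_iff simp flip: distrib_left simp del: index_mult_mat_vec)
  qed
  then show ?thesis unfolding backward_error_def by metis
qed

section \<open>Closed formulas for both backward errors\<close>

context
  fixes s :: complex and N k :: nat and u :: "complex vec" and t :: real and Q :: "complex poly mat"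
  assumes s: "s = 1 \<or> s = -1" and Q: "Q \<in> sign_Herm_polys s k N"
    and u: "u \<in> carrier_vec N" "vec_norm2 u = 1"
begin

private lemma QC: "Q \<in> carrier_mat N N"
  using Q by (simp add: sign_Herm_polys_def mat_polys_def)

private lemma Qu: "mat_eval Q (of_real t) *\<^sub>v u \<in> carrier_vec N"
  using QC u(1) by (intro mult_mat_vec_carrier[of _ N N]) auto

private lemma inner_residual:
  "cinner N (($) u) (($) (- (mat_eval Q (of_real t) *\<^sub>v u)))
    = - cinner N (($) u) (($) (mat_eval Q (of_real t) *\<^sub>v u))"
  using Qu by (rule cinner_uminus_vec)

private lemma norm_residual:
  "vec_norm2 (- (mat_eval Q (of_real t) *\<^sub>v u)) = vec_norm2 (mat_eval Q (of_real t) *\<^sub>v u)"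
  by (simp add: vec_norm2_def del: index_mult_mat_vec)

private lemma cnj_inner_residual:
  "cnj (cinner N (($) u) (($) (- (mat_eval Q (of_real t) *\<^sub>v u))))
    = s * cinner N (($) u) (($) (- (mat_eval Q (of_real t) *\<^sub>v u)))"
  unfolding inner_residual
  using sign_Herm_quadratic_form[OF mat_eval_sign_Herm[OF Q Reals_of_real] s u(1)] by simp

private lemma residual: "- (mat_eval Q (of_real t) *\<^sub>v u) \<in> carrier_vec N"
  using Qu by simp

lemma backward_error_frobenius:
  "backward_error frobenius_norm (sign_Herm_polys s k N) k (of_real t) u Q
    = sqrt (2 * (vec_norm2 (mat_eval Q (of_real t) *\<^sub>v u))\<^sup>2
        - (cmod (cinner N (($) u) (($) (mat_eval Q (of_real t) *\<^sub>v u))))\<^sup>2)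
      / sqrt (\<Sum>j\<le>k. t ^ (2 * j))"
proof -
  \<comment> \<open>These discharge the hypotheses on the extremal matrices for
    \<open>r = - Q(t) u\<close>: \<open>refl\<close> instantiates \<open>a\<close> with the inner
    product, and the last fact is the solvability condition.\<close>
  note * = s u residual refl cnj_inner_residual
  show ?thesis
  proof (rule backward_error_eq_min[OF _ _ _ QC u(1) _ frobenius_extremal_sign_Herm[OF *]
        frobenius_extremal_mult[OF *]])
    show "\<And>E. E \<in> sign_Herm s N \<Longrightarrow> E *\<^sub>v u = - (mat_eval Q (of_real t) *\<^sub>v u) \<Longrightarrow>
      sqrt (2 * (vec_norm2 (mat_eval Q (of_real t) *\<^sub>v u))\<^sup>2
        - (cmod (cinner N (($) u) (($) (mat_eval Q (of_real t) *\<^sub>v u))))\<^sup>2) \<le> frobenius_norm E"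
      using frobenius_norm_ge[OF *] by (simp add: inner_residual norm_residual)
    show "frobenius_norm (frobenius_extremal s N u (- (mat_eval Q (of_real t) *\<^sub>v u)))
      \<le> sqrt (2 * (vec_norm2 (mat_eval Q (of_real t) *\<^sub>v u))\<^sup>2
        - (cmod (cinner N (($) u) (($) (mat_eval Q (of_real t) *\<^sub>v u))))\<^sup>2)"
      using frobenius_norm_extremal[OF *]
      by (intro real_le_rsqrt) (simp add: inner_residual norm_residual)
  qed (auto simp: frobenius_norm_add frobenius_norm_smult)
qed

lemma backward_error_spectral:
  assumes "N > 0"
  shows "backward_error spectral_norm (sign_Herm_polys s k N) k (of_real t) u Q
    = vec_norm2 (mat_eval Q (of_real t) *\<^sub>v u) / sqrt (\<Sum>j\<le>k. t ^ (2 * j))"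
proof -
  note * = s u residual refl cnj_inner_residual
  show ?thesis
  proof (rule backward_error_eq_min[OF _ _ _ QC u(1) _ spectral_extremal_sign_Herm[OF *]
        spectral_extremal_mult[OF *]])
    show "\<And>E. E \<in> sign_Herm s N \<Longrightarrow> E *\<^sub>v u = - (mat_eval Q (of_real t) *\<^sub>v u) \<Longrightarrow>
      vec_norm2 (mat_eval Q (of_real t) *\<^sub>v u) \<le> spectral_norm E"
      using spectral_norm_ge[OF *] by (simp add: norm_residual)
    show "spectral_norm (spectral_extremal s N u (- (mat_eval Q (of_real t) *\<^sub>v u)))
      \<le> vec_norm2 (mat_eval Q (of_real t) *\<^sub>v u)"
      using spectral_norm_extremal_le[OF * assms] by (simp add: norm_residual)
  qed (use assms in \<open>auto simp: spectral_norm_add spectral_norm_smult_le spectral_norm_nonneg\<close>)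
qed

end

section \<open>The ansatz equation\<close>

text \<open>The indices split into \<open>m\<close> consecutive blocks of length \<open>n\<close>,
  one for each quotient. This makes inner products of Kronecker products factor.\<close>

lemma sum_div_mod:
  fixes f g :: "nat \<Rightarrow> 'a::comm_semiring_0"
  shows "(\<Sum>i<m * n. f (i div n) * g (i mod n)) = (\<Sum>i<m. f i) * (\<Sum>j<n. g j)"
proof -
  have "(\<Sum>i<m * n. f (i div n) * g (i mod n))
      = (\<Sum>i<m. \<Sum>j = i * n..<i * n + n. f (j div n) * g (j mod n))"
    by (rule sum.nat_group[symmetric])
  also have "\<dots> = (\<Sum>i<m. \<Sum>j<n. f i * g j)"
  proof (rule sum.cong)
    fix i
    have "(\<Sum>j = i * n..<i * n + n. f (j div n) * g (j mod n))
        = (\<Sum>j = 0..<n. f ((j + i * n) div n) * g ((j + i * n) mod n))"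
      using sum.shift_bounds_nat_ivl[of "\<lambda>j. f (j div n) * g (j mod n)" 0 "i * n" n]
      by (simp add: add.commute)
    also have "\<dots> = (\<Sum>j<n. f i * g j)"
      by (intro sum.cong) auto
    finally show "(\<Sum>j = i * n..<i * n + n. f (j div n) * g (j mod n)) = (\<Sum>j<n. f i * g j)" .
  qed simp
  finally show ?thesis by (simp add: sum_product)
qed

section \<open>Kronecker products of vectors\<close>

lemma kron_vec_carrier: "u \<in> carrier_vec m \<Longrightarrow> x \<in> carrier_vec n \<Longrightarrow> kron_vec u x \<in> carrier_vec (m * n)"
  by (auto simp: kron_vec_def kron_def col_mat_def)

lemma kron_vec_index:
  assumes "u \<in> carrier_vec m" "x \<in> carrier_vec n" "i < m * n"
  shows "kron_vec u x $ i = u $ (i div n) * x $ (i mod n)"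
proof -
  have "n > 0" "i div n < m" using assms(3) by (cases n, auto simp: less_mult_imp_div_less)
  then show ?thesis
    using assms by (auto simp: kron_vec_def kron_def col_mat_def mat_of_cols_index)
qed

lemma cinner_kron_vec:
  assumes "u \<in> carrier_vec m" "u' \<in> carrier_vec m" "x \<in> carrier_vec n" "x' \<in> carrier_vec n"
  shows "cinner (m * n) (($) (kron_vec u x)) (($) (kron_vec u' x'))
    = cinner m (($) u) (($) u') * cinner n (($) x) (($) x')"
  unfolding cinner_def sum_div_mod[symmetric]
  using assms by (intro sum.cong) (auto simp: kron_vec_index)

lemma vec_norm2_kron_vec:
  assumes "u \<in> carrier_vec m" "x \<in> carrier_vec n"
  shows "vec_norm2 (kron_vec u x) = vec_norm2 u * vec_norm2 x"
proof -
  have "complex_of_real ((vec_norm2 (kron_vec u x))\<^sup>2) = of_real ((vec_norm2 u * vec_norm2 x)\<^sup>2)"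
    using cinner_kron_vec[OF assms(1,1,2,2)] kron_vec_carrier[OF assms] assms
    by (simp add: cinner_vec_norm2 power_mult_distrib)
  then have "(vec_norm2 (kron_vec u x))\<^sup>2 = (vec_norm2 u * vec_norm2 x)\<^sup>2"
    using of_real_eq_iff by blast
  then show ?thesis by (simp add: power2_eq_iff_nonneg)
qed

lemma kron_col_mat_mult_vec:
  fixes A :: "complex mat"
  assumes "w \<in> carrier_vec m" "A \<in> carrier_mat n n" "x \<in> carrier_vec n"
  shows "kron (col_mat w) A *\<^sub>v x = kron_vec w (A *\<^sub>v x)"
proof (rule eq_vecI)
  have Ax: "A *\<^sub>v x \<in> carrier_vec n" using assms by auto
  show "dim_vec (kron (col_mat w) A *\<^sub>v x) = dim_vec (kron_vec w (A *\<^sub>v x))"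
    using assms by (auto simp: kron_vec_def kron_def col_mat_def)
  fix i assume "i < dim_vec (kron_vec w (A *\<^sub>v x))"
  then have i: "i < m * n" using kron_vec_carrier[OF assms(1) Ax] by simp
  then have n: "n > 0" "i div n < m" by (cases n, auto simp: less_mult_imp_div_less)
  have K: "kron (col_mat w) A \<in> carrier_mat (m * n) n"
    using assms by (auto simp: kron_def col_mat_def)
  have "(kron (col_mat w) A *\<^sub>v x) $ i = (\<Sum>j<n. w $ (i div n) * (A $$ (i mod n, j) * x $ j))"
    unfolding mult_mat_vec_index[OF K assms(3) i]
    using assms i n by (intro sum.cong) (auto simp: kron_def col_mat_def mat_of_cols_index)
  also have "\<dots> = kron_vec w (A *\<^sub>v x) $ i"
    unfolding kron_vec_index[OF assms(1) Ax i] using n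
    by (subst mult_mat_vec_index[OF assms(2,3)]) (auto simp: sum_distrib_left)
  finally show "(kron (col_mat w) A *\<^sub>v x) $ i = kron_vec w (A *\<^sub>v x) $ i" .
qed

text \<open>Since \<open>\<Lambda> \<otimes> x = (\<Lambda> \<otimes> I) x\<close>, this is the
  ansatz identity applied to \<open>x\<close>.\<close>

lemma mat_eval_ansatz:
  assumes "m \<ge> 1" "L \<in> carrier_mat (m * n) (m * n)" "P \<in> carrier_mat n n" "x \<in> carrier_vec n"
    and "right_ansatz_vector m n P L v"
  shows "mat_eval L z *\<^sub>v kron_vec (Lam (m - 1) z) x = kron_vec v (mat_eval P z *\<^sub>v x)"
proof -
  have v: "v \<in> carrier_vec m" and Lam: "Lam (m - 1) z \<in> carrier_vec m"
    using assms by (auto simp: right_ansatz_vector_def Lam_def)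
  have "kron_vec (Lam (m - 1) z) x = kron (col_mat (Lam (m - 1) z)) (1\<^sub>m n) *\<^sub>v x"
    using kron_col_mat_mult_vec[OF Lam one_carrier_mat assms(4)] assms(4) by simp
  moreover have "kron (col_mat (Lam (m - 1) z)) (1\<^sub>m n) \<in> carrier_mat (m * n) n"
    using Lam by (auto simp: kron_def col_mat_def)
  ultimately have "mat_eval L z *\<^sub>v kron_vec (Lam (m - 1) z) x
      = (mat_eval L z * kron (col_mat (Lam (m - 1) z)) (1\<^sub>m n)) *\<^sub>v x"
    using assms by (simp add: assoc_mult_mat_vec[of _ "m * n" "m * n" _ n])
  also have "\<dots> = kron (col_mat v) (mat_eval P z) *\<^sub>v x"
    using assms(5) by (simp add: right_ansatz_vector_def)
  also have "\<dots> = kron_vec v (mat_eval P z *\<^sub>v x)"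
    using assms v by (intro kron_col_mat_mult_vec) auto
  finally show ?thesis .
qed

lemma vec_norm2_Lam: "(vec_norm2 (Lam k (of_real t)))\<^sup>2 = (\<Sum>j\<le>k. t ^ (2 * j))"
proof -
  have "(cmod (Lam k (of_real t) $ i))\<^sup>2 = (t ^ (k - i))\<^sup>2" if "i < Suc k" for i
    using that by (simp add: Lam_def norm_power flip: power_abs)
  then have "(vec_norm2 (Lam k (of_real t)))\<^sup>2 = (\<Sum>i<Suc k. (t ^ (k - i))\<^sup>2)"
    unfolding vec_norm2_def by (subst real_sqrt_pow2)
      (auto intro!: sum_nonneg sum.cong simp: Lam_def simp del: sum.lessThan_Suc)
  \<comment> \<open>\<open>Lam\<close> lists the powers in descending order, so the index is
    reversed.\<close>
  also have "\<dots> = (\<Sum>j<Suc k. (t ^ j)\<^sup>2)"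
    using sum.nat_diff_reindex[of "\<lambda>j. (t ^ j)\<^sup>2" "Suc k"] by simp
  finally show ?thesis by (simp add: lessThan_Suc_atMost power_even_eq)
qed

section \<open>Comparison of the backward errors\<close>

lemma geometric_sum_le_endpoints:
  fixes q :: real
  assumes "q \<ge> 0"
  shows "2 * (\<Sum>j\<le>m. q ^ j) \<le> (real m + 1) * (1 + q ^ m)"
proof -
  have "q ^ j + q ^ (m - j) \<le> 1 + q ^ m" if "j \<le> m" for j
  proof -
    \<comment> \<open>Both factors are nonnegative for \<open>q \<le> 1\<close> and nonpositive
      otherwise.\<close>
    have "0 \<le> (1 - q ^ j) * (1 - q ^ (m - j))"
    proof (cases "q \<le> 1")
      case True
      then show ?thesis using assms by (simp add: power_le_one)
    next
      case False
      then show ?thesis by (intro mult_nonpos_nonpos) (simp_all add: one_le_power)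
    qed
    moreover have "q ^ j * q ^ (m - j) = q ^ m" using that by (simp flip: power_add)
    ultimately show ?thesis by (simp add: algebra_simps)
  qed
  then have "(\<Sum>j\<le>m. q ^ j + q ^ (m - j)) \<le> (\<Sum>j\<le>m. 1 + q ^ m)"
    by (intro sum_mono) auto
  moreover have "(\<Sum>j\<le>m. q ^ (m - j)) = (\<Sum>j\<le>m. q ^ j)"
    using sum.nat_diff_reindex[of "\<lambda>j. q ^ j" "Suc m"] by (simp add: lessThan_Suc_atMost)
  ultimately show ?thesis by (simp add: sum.distrib algebra_simps)
qed

lemma geometric_sum_product_bounds:
  fixes q :: real
  assumes "q \<ge> 0"
  defines "W \<equiv> \<lambda>k. \<Sum>j\<le>k. q ^ j"
  assumes "m \<ge> 1"
  shows "W m \<le> W (m - 1) * W 1" "(real m + 1) * (W (m - 1) * W 1) \<le> 2 * real m * W m"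
proof -
  obtain l where l: "m = Suc l" using assms(3) by (cases m) auto
  have W1: "W 1 = 1 + q" by (simp add: W_def)
  have up: "W m = W l + q ^ m" by (simp add: W_def l)
  have "q * W l = (\<Sum>j\<le>l. q ^ Suc j)" by (simp add: W_def sum_distrib_left)
  then have down: "W m = 1 + q * W l" unfolding W_def l sum.atMost_Suc_shift by simp
  \<comment> \<open>The product is \<open>W l + q * W l\<close>, where
    \<open>W l = W m - q ^ m\<close> and \<open>q * W l = W m - 1\<close>.\<close>
  have prod: "W (m - 1) * W 1 = 2 * W m - (1 + q ^ m)"
    unfolding W1 using up down by (simp add: l algebra_simps)
  have "q ^ m \<le> q * W l"
    using assms(1) member_le_sum[of l "{..l}" "\<lambda>j. q ^ j"]
    by (simp add: l W_def mult_left_mono)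
  then show "W m \<le> W (m - 1) * W 1" using down prod by simp
  have "2 * W m \<le> (real m + 1) * (1 + q ^ m)"
    unfolding W_def by (rule geometric_sum_le_endpoints[OF assms(1)])
  then show "(real m + 1) * (W (m - 1) * W 1) \<le> 2 * real m * W m"
    unfolding prod by (simp add: algebra_simps)
qed

theorem theorem4p9:
  fixes m n :: nat
    and P L :: "complex poly mat"
    and lam :: complex
    and x v :: "complex vec"
    and S T :: "nat \<Rightarrow> nat \<Rightarrow> complex poly mat set"
  assumes "m \<ge> 1" and "n \<ge> 1"
    and "T \<in> {Herm, skew_Herm}"
    and "P \<in> T m n" and "regular P"
    and "x \<in> carrier_vec n" and "vec_norm2 x = 1"
    and "mat_eval P lam *\<^sub>v x \<noteq> 0\<^sub>v n"
    and "S \<in> {Herm, skew_Herm}"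
    and "L \<in> L1_space m n P" and "linearization m n P L" and "L \<in> S 1 (m * n)"
    and "right_ansatz_vector m n P L v" and "vec_norm2 v = 1"
    and "lam \<in> \<real>"
  shows
    "sqrt ((real m + 1) / (2 * real m))
       \<le> backward_error frobenius_norm (S 1 (m * n)) 1 lam (kron_vec (Lam (m - 1) lam) x) L
          / backward_error frobenius_norm (T m n) m lam x P
     \<and> backward_error frobenius_norm (S 1 (m * n)) 1 lam (kron_vec (Lam (m - 1) lam) x) L
          / backward_error frobenius_norm (T m n) m lam x P \<le> sqrt 2
     \<and> sqrt ((real m + 1) / (2 * real m))
       \<le> backward_error spectral_norm (S 1 (m * n)) 1 lam (kron_vec (Lam (m - 1) lam) x) L
          / backward_error spectral_norm (T m n) m lam x P
     \<and> backward_error spectral_norm (S 1 (m * n)) 1 lam (kron_vec (Lam (m - 1) lam) x) L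
          / backward_error spectral_norm (T m n) m lam x P \<le> 1"
proof -
  obtain t where lam: "lam = of_real t" using assms(15) by (elim Reals_cases)
  \<comment> \<open>The signs are independent, as the structure of \<open>L\<close> may differ from
    that of \<open>P\<close>.\<close>
  obtain s s' where s: "s = 1 \<or> s = -1" "S = sign_Herm_polys s"
    and s': "s' = 1 \<or> s' = -1" "T = sign_Herm_polys s'"
    using assms(3,9) Herm_eq_sign_Herm_polys skew_Herm_eq_sign_Herm_polys by (metis ext insertE singletonD)
  define W where "W = (\<lambda>k. \<Sum>j\<le>k. t ^ (2 * j))"
  have W_pos: "W k > 0" for k unfolding W_def by (rule sum_even_powers_pos)
  have PT: "P \<in> sign_Herm_polys s' m n" and LS: "L \<in> sign_Herm_polys s 1 (m * n)"
    using assms s' s by auto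
  have PC: "P \<in> carrier_mat n n" and LC: "L \<in> carrier_mat (m * n) (m * n)"
    using PT LS by (auto simp: sign_Herm_polys_def mat_polys_def)
  have v: "v \<in> carrier_vec m" using assms(13) by (simp add: right_ansatz_vector_def)
  define y where "y = mat_eval P lam *\<^sub>v x"
  have y: "y \<in> carrier_vec n" unfolding y_def using PC assms(6) by (intro mult_mat_vec_carrier) auto
  define \<rho> where "\<rho> = vec_norm2 y"
  have rho: "\<rho> > 0"
    using assms(8) vec_norm2_eq_0_iff[OF y] vec_norm2_nonneg[of y]
    unfolding \<rho>_def y_def by linarith
  define \<alpha> where "\<alpha> = cmod (cinner n (($) x) (($) y))"
  have alpha: "0 \<le> \<alpha>" "\<alpha> \<le> \<rho>"
    using cmod_cinner_le[OF assms(6) y] assms(7) by (auto simp: \<alpha>_def \<rho>_def)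
  define \<Lambda> where "\<Lambda> = Lam (m - 1) lam"
  have Lam: "\<Lambda> \<in> carrier_vec m" using assms(1) by (auto simp: \<Lambda>_def Lam_def)
  define \<sigma> where "\<sigma> = vec_norm2 \<Lambda>"
  have sigma2: "\<sigma>\<^sup>2 = W (m - 1)"
    unfolding \<sigma>_def \<Lambda>_def lam W_def by (rule vec_norm2_Lam)
  have sigma: "\<sigma> > 0"
    using W_pos[of "m - 1"] sigma2 vec_norm2_nonneg[of \<Lambda>] unfolding \<sigma>_def
    by (metis less_irrefl order_le_less zero_power2)
  define \<gamma> where "\<gamma> = cmod (cinner m (($) \<Lambda>) (($) v))"
  have gamma: "0 \<le> \<gamma>" "\<gamma> \<le> \<sigma>"
    using cmod_cinner_le[OF Lam v] assms(14) by (auto simp: \<gamma>_def \<sigma>_def)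
  \<comment> \<open>\<open>c\<close> normalizes \<open>\<Lambda> \<otimes> x\<close>, whose norm is
    \<open>\<sigma>\<close> because \<open>x\<close> is a unit vector.\<close>
  define c where "c = complex_of_real (1 / \<sigma>)"
  have c: "c \<noteq> 0" "cmod c = 1 / \<sigma>" using sigma by (auto simp: c_def norm_divide)
  define k where "k = kron_vec \<Lambda> x"
  have k: "k \<in> carrier_vec (m * n)" unfolding k_def using Lam assms(6) by (rule kron_vec_carrier)
  have vy: "kron_vec v y \<in> carrier_vec (m * n)" using v y by (rule kron_vec_carrier)
  have norm_k: "vec_norm2 k = \<sigma>"
    using vec_norm2_kron_vec[OF Lam assms(6)] assms(7) by (simp add: k_def \<sigma>_def)
  have ck: "c \<cdot>\<^sub>v k \<in> carrier_vec (m * n)" "vec_norm2 (c \<cdot>\<^sub>v k) = 1"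
    using k sigma by (auto simp: vec_norm2_smult c norm_k)
  have Lck: "mat_eval L lam *\<^sub>v (c \<cdot>\<^sub>v k) = c \<cdot>\<^sub>v kron_vec v y"
    using mat_eval_ansatz[OF assms(1) LC PC assms(6,13), of lam] LC k
    by (simp add: mult_mat_vec[of _ "m * n" "m * n"] k_def \<Lambda>_def y_def)
  have norm_Lck: "vec_norm2 (c \<cdot>\<^sub>v kron_vec v y) = \<rho> / \<sigma>"
    using vec_norm2_kron_vec[OF v y] assms(14) by (simp add: vec_norm2_smult c \<rho>_def)
  have "cinner (m * n) (($) (c \<cdot>\<^sub>v k)) (($) (c \<cdot>\<^sub>v kron_vec v y))
      = cinner (m * n) (\<lambda>i. c * k $ i) (\<lambda>i. c * kron_vec v y $ i)"
    using k vy by (intro cinner_cong) auto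
  also have "\<dots> = cnj c * c * (cinner m (($) \<Lambda>) (($) v) * cinner n (($) x) (($) y))"
    using cinner_kron_vec[OF Lam v assms(6) y] by (simp add: cinner_simps k_def)
  finally have inner_Lck: "cmod (cinner (m * n) (($) (c \<cdot>\<^sub>v k)) (($) (c \<cdot>\<^sub>v kron_vec v y)))
      = \<gamma> * \<alpha> / \<sigma>\<^sup>2"
    by (simp add: norm_mult c \<gamma>_def \<alpha>_def power2_eq_square)
  have mn: "m * n > 0" using assms(1,2) by simp
  have scale: "backward_error nrm (S 1 (m * n)) 1 lam k L
      = backward_error nrm (S 1 (m * n)) 1 lam (c \<cdot>\<^sub>v k) L" for nrm
    using c(1) k LC by (intro backward_error_smult[symmetric]) (auto simp: s(2) sign_Herm_polys_def)
  define f2 fF g2 gF where "f2 = backward_error spectral_norm (T m n) m lam x P"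
    and "fF = backward_error frobenius_norm (T m n) m lam x P"
    and "g2 = backward_error spectral_norm (S 1 (m * n)) 1 lam k L"
    and "gF = backward_error frobenius_norm (S 1 (m * n)) 1 lam k L"
  have f2: "f2 = \<rho> / sqrt (W m)"
    using backward_error_spectral[OF s'(1) PT assms(6,7), of t] assms(2)
    by (simp add: f2_def s'(2) lam W_def \<rho>_def y_def)
  have fF: "fF = sqrt (2 * \<rho>\<^sup>2 - \<alpha>\<^sup>2) / sqrt (W m)"
    using backward_error_frobenius[OF s'(1) PT assms(6,7), of t]
    by (simp only: fF_def s'(2) lam W_def \<rho>_def y_def \<alpha>_def)
  have g2: "g2 = \<rho> / \<sigma> / sqrt (W 1)"
    using backward_error_spectral[OF s(1) LS ck mn, of t]
    by (simp only: g2_def s(2) scale[unfolded s(2)] Lck norm_Lck W_def flip: lam)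
  have gF: "gF = sqrt (2 * (\<rho> / \<sigma>)\<^sup>2 - (\<gamma> * \<alpha> / \<sigma>\<^sup>2)\<^sup>2) / sqrt (W 1)"
    using backward_error_frobenius[OF s(1) LS ck, of t]
    by (simp only: gF_def s(2) scale[unfolded s(2)] Lck norm_Lck inner_Lck W_def flip: lam)
  \<comment> \<open>The quotient \<open>g2 / f2\<close> of the spectral errors, in which
    \<open>\<rho>\<close> cancels.\<close>
  define \<kappa> where "\<kappa> = sqrt (W m) / (\<sigma> * sqrt (W 1))"
  have kappa: "\<kappa> = sqrt (W m / (W (m - 1) * W 1))"
    unfolding \<kappa>_def sigma2[symmetric] using sigma by (simp add: real_sqrt_mult real_sqrt_divide)
  have WW: "W (m - 1) * W 1 > 0" using W_pos by simp
  have bounds: "W m \<le> W (m - 1) * W 1"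
    "(real m + 1) * (W (m - 1) * W 1) \<le> 2 * real m * W m"
    using geometric_sum_product_bounds[of "t\<^sup>2" m] assms(1) by (simp_all only: W_def power_mult zero_le_power2)
  have kappa_le: "\<kappa> \<le> 1" unfolding kappa using bounds(1) WW by simp
  have kappa_ge: "sqrt ((real m + 1) / (2 * real m)) \<le> \<kappa>"
    unfolding kappa using bounds(2) WW assms(1) by (simp add: field_simps)
  have kappa_pos: "\<kappa> > 0" using sigma W_pos by (simp add: \<kappa>_def)
  have f2_pos: "f2 > 0" using rho W_pos by (simp add: f2)
  have "g2 = \<kappa> * f2"
    using W_pos[of m] W_pos[of 1] sigma by (simp add: g2 f2 \<kappa>_def field_simps)
  then have r2: "g2 / f2 = \<kappa>" using f2_pos by simp
  \<comment> \<open>By Cauchy-Schwarz the radicand in \<open>fF\<close> is at least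
    \<open>\<rho>\<^sup>2\<close>, so the Frobenius error dominates the spectral one.\<close>
  have "\<alpha>\<^sup>2 \<le> \<rho>\<^sup>2" using alpha by (intro power_mono)
  then have "\<rho> \<le> sqrt (2 * \<rho>\<^sup>2 - \<alpha>\<^sup>2)" by (intro real_le_rsqrt) simp
  then have f2_le: "f2 \<le> fF" unfolding f2 fF using W_pos[of m] by (simp add: divide_right_mono)
  then have fF_pos: "fF > 0" using f2_pos by simp
  \<comment> \<open>Upper bound: discarding the subtracted square leaves \<open>sqrt 2 * g2\<close>,
    and \<open>g2 = \<kappa> * f2\<close> with \<open>\<kappa> \<le> 1\<close> and
    \<open>f2 \<le> fF\<close>.\<close>
  have "gF \<le> sqrt (2 * (\<rho> / \<sigma>)\<^sup>2) / sqrt (W 1)"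
    unfolding gF using W_pos[of 1] by (intro divide_right_mono real_sqrt_le_mono) auto
  also have "\<dots> = sqrt 2 * g2" using rho sigma by (simp add: g2 real_sqrt_mult)
  also have "\<dots> = sqrt 2 * (\<kappa> * f2)" using \<open>g2 = \<kappa> * f2\<close> by simp
  also have "\<dots> \<le> sqrt 2 * (1 * fF)"
    using kappa_le f2_le f2_pos by (intro mult_left_mono mult_mono) auto
  finally have gF_le: "gF / fF \<le> sqrt 2" using fF_pos by (simp add: field_simps)
  \<comment> \<open>Lower bound: after the common scaling, \<open>\<kappa> * fF\<close> and
    \<open>gF\<close> differ only in the subtracted squares of \<open>\<alpha> / \<sigma>\<close>
    and \<open>\<gamma> * \<alpha> / \<sigma>\<^sup>2\<close>. The second is no larger since
    \<open>\<gamma> \<le> \<sigma>\<close>, which rests on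
    \<open>\<parallel>v\<parallel> = 1\<close>.\<close>
  have "\<kappa> * fF = sqrt (2 * \<rho>\<^sup>2 - \<alpha>\<^sup>2) / \<sigma> / sqrt (W 1)"
    using W_pos[of m] by (simp add: fF \<kappa>_def)
  also have "sqrt (2 * \<rho>\<^sup>2 - \<alpha>\<^sup>2) / \<sigma> = sqrt ((2 * \<rho>\<^sup>2 - \<alpha>\<^sup>2) / \<sigma>\<^sup>2)"
    using sigma by (simp add: real_sqrt_divide)
  also have "\<dots> / sqrt (W 1) \<le> gF"
    unfolding gF
  proof (intro divide_right_mono real_sqrt_le_mono)
    have "\<gamma>\<^sup>2 * \<alpha>\<^sup>2 \<le> \<sigma>\<^sup>2 * \<alpha>\<^sup>2" using gamma by (intro mult_right_mono power_mono) auto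
    then have "(\<gamma> * \<alpha> / \<sigma>\<^sup>2)\<^sup>2 \<le> \<sigma>\<^sup>2 * \<alpha>\<^sup>2 / (\<sigma>\<^sup>2)\<^sup>2"
      unfolding power_divide power_mult_distrib by (rule divide_right_mono) simp
    also have "\<dots> = \<alpha>\<^sup>2 / \<sigma>\<^sup>2" using sigma by (simp add: power2_eq_square)
    finally show "(2 * \<rho>\<^sup>2 - \<alpha>\<^sup>2) / \<sigma>\<^sup>2 \<le> 2 * (\<rho> / \<sigma>)\<^sup>2 - (\<gamma> * \<alpha> / \<sigma>\<^sup>2)\<^sup>2"
      by (simp add: power_divide diff_divide_distrib)
  qed (use W_pos[of 1] in simp)
  finally have "\<kappa> \<le> gF / fF" using fF_pos by (simp add: field_simps)
  then show ?thesis
    using kappa_ge kappa_le gF_le r2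
    unfolding f2_def fF_def g2_def gF_def k_def \<Lambda>_def by (intro conjI) linarith+
qed

end
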